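(* Let $G$ be a finite group. Then the co-prime graph $\Gamma(G)$ is claw-free if and only if $|G|\leq 3$.
   Context: For a finite group $G$, the co-prime graph $\Gamma(G)$ is the simple undirected graph with vertex set $G$ (including the identity) in which two distinct vertices $x,y$ are adjacent if and only if $\gcd(o(x),o(y))=1$, where $o(g)$ denotes the order of $g$. A graph is claw-free if it contains no induced subgraph isomorphic to $K_{1,3}$. *)

theory Defs
  imports "HOL-Algebra.Multiplicative_Group" "Graph_Theory.Graph_Theory"
begin

text \<open>
  As in \<^theory>\<open>Graph_Theory.Digraph\<close>, a finite simple undirected graph is a finite symmetric
  digraph without loops and parallel arcs (locale \<^locale>\<open>graph\<close>): every edge is represented by
  the two arcs \<open>(x, y)\<close> and \<open>(y, x)\<close>.
\<close>

definition coprime_graph :: "('a, 'm) monoid_scheme \<Rightarrow> ('a, 'a \<times> 'a) pre_digraph" where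
  "coprime_graph G = with_proj
     \<lparr> pverts = carrier G,
       parcs = {(x, y). x \<in> carrier G \<and> y \<in> carrier G \<and> x \<noteq> y \<and>
                        gcd (group.ord G x) (group.ord G y) = 1} \<rparr>"

text \<open>
  No isomorphism is mentioned below, because \<^const>\<open>complete_bipartite_digraph\<close> is a predicate
  on graphs that is closed under isomorphism.
\<close>

definition claw_free :: "('v, 'e) pre_digraph \<Rightarrow> bool" where
  "claw_free \<Gamma> \<longleftrightarrow> \<not> (\<exists>H. induced_subgraph H \<Gamma> \<and> complete_bipartite_digraph 1 3 H)"

lemma graph_coprime_graph:
  assumes "finite (carrier G)"
  shows "graph (coprime_graph G)"
proof -
  let ?A = "{(x, y). x \<in> carrier G \<and> y \<in> carrier G \<and> x \<noteq> y \<and>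
                     gcd (group.ord G x) (group.ord G y) = 1}"
  have "finite ?A"
    by (rule finite_subset[of _ "carrier G \<times> carrier G"]) (use assms in auto)
  then show ?thesis
    unfolding coprime_graph_def
    by unfold_locales
      (use assms in \<open>auto simp: arc_to_ends_def symmetric_def sym_def gcd.commute\<close>)
qed

end

theory Submission
  imports Defs
begin

text \<open>
  The identity is coprime to every element, so it serves as the centre of a claw as soon as three
  distinct elements other than the identity have orders that are pairwise not coprime. Claw-freeness
  thus forbids such triples (\<open>claw_free_imp_coprime_pair\<close>), and it remains to find one in every finite
  group with at least four elements.

  An element \<open>x\<close> of order at least four gives the triple \<open>x\<close>, \<open>x\<inverse>\<close>, \<open>x\<^sup>2\<close>: the order of \<open>x\<^sup>2\<close>
  divides the order that the other two share. Otherwise every element but the identity has order two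
  or three, and without a triple each of these orders occurs at most twice. Four elements then force
  both orders to occur, say at \<open>a\<close> and \<open>b\<close> respectively. Now \<open>b\<close> and \<open>b\<inverse>\<close> exhaust the elements of
  order three, so the coset \<open>{a, a b, a b\<inverse>}\<close>, which is disjoint from the subgroup generated by
  \<open>b\<close>, consists of three elements of order two, which is a triple after all.

  Conversely, a claw has four vertices and needs a group with at least four elements.
\<close>

text \<open>
  Otherwise the identity, as the centre, and \<open>L\<close>, as the set of leaves, would induce a claw.
\<close>

lemma (in group) claw_free_imp_coprime_pair:
  assumes free: "claw_free (coprime_graph G)" and fin: "finite (carrier G)"
    and L: "L \<subseteq> carrier G" "\<one> \<notin> L" "card L = 3"
  shows "\<exists>x \<in> L. \<exists>y \<in> L. x \<noteq> y \<and> coprime (ord x) (ord y)"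
proof (rule ccontr)
  assume "\<not> ?thesis"
  then have not_adjacent: "gcd (ord x) (ord y) \<noteq> 1" if "x \<in> L" "y \<in> L" "x \<noteq> y" for x y
    using that coprime_iff_gcd_eq_1 by blast
  define P where "P = \<lparr>pverts = insert \<one> L, parcs = {\<one>} \<times> L \<union> L \<times> {\<one>}\<rparr>"
  have finL: "finite L"
    using L(1) fin by (rule finite_subset)
  have bipartite: "complete_bipartite_digraph 1 3 (with_proj P)"
    unfolding complete_bipartite_digraph_pair_def
  proof (intro conjI exI)
    show "finite (pverts P)"
      using finL by (simp add: P_def)
    show "pverts P = {\<one>} \<union> L" "parcs P = {\<one>} \<times> L \<union> L \<times> {\<one>}"
      by (simp_all add: P_def)
    show "{\<one>} \<inter> L = {}" "card {\<one>} = 1" "card L = 3"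
      using L by simp_all
  qed
  have arc_iff: "(x, y) \<in> parcs P \<longleftrightarrow> x \<in> insert \<one> L \<and> y \<in> insert \<one> L \<and> x \<noteq> y \<and> gcd (ord x) (ord y) = 1"
    for x y
    using L(2) not_adjacent[of x y] by (auto simp: P_def)
  have "graph (with_proj P)"
    using bipartite by (simp add: complete_bipartite_digraph_def)
  moreover have "graph (coprime_graph G)"
    by (rule graph_coprime_graph[OF fin])
  ultimately have wf: "wf_digraph (with_proj P)" "wf_digraph (coprime_graph G)"
    by (simp_all add: graph_def digraph_def fin_digraph_def)
  have sub: "insert \<one> L \<subseteq> carrier G"
    using L by simp
  have arcs: "arcs (with_proj P) = {e \<in> arcs (coprime_graph G).
      tail (coprime_graph G) e \<in> insert \<one> L \<and> head (coprime_graph G) e \<in> insert \<one> L}"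
    using sub by (auto simp: coprime_graph_def arc_iff)
  have "induced_subgraph (with_proj P) (coprime_graph G)"
    unfolding induced_subgraph_def subgraph_def
  proof (intro conjI wf)
    show "compatible (coprime_graph G) (with_proj P)"
      by (simp add: coprime_graph_def compatible_def)
    show "verts (with_proj P) \<subseteq> verts (coprime_graph G)"
      using sub by (simp add: coprime_graph_def P_def)
    show "arcs (with_proj P) \<subseteq> arcs (coprime_graph G)"
      unfolding arcs by blast
    have "verts (with_proj P) = insert \<one> L"
      by (simp add: P_def)
    then show "arcs (with_proj P) = {e \<in> arcs (coprime_graph G).
        tail (coprime_graph G) e \<in> verts (with_proj P) \<and>
        head (coprime_graph G) e \<in> verts (with_proj P)}"
      using arcs by (simp only:)
  qed
  with bipartite free show False
    unfolding claw_free_def by blast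
qed

text \<open>
  For \<open>ord x \<ge> 4\<close> the elements \<open>x\<close>, \<open>x\<inverse>\<close> and \<open>x\<^sup>2\<close> are distinct and not the identity, because
  \<open>x\<close>, \<open>x\<^sup>2\<close> and \<open>x\<^sup>3\<close> are not the identity, and \<open>ord (x\<^sup>2)\<close> is a nontrivial common divisor of
  their orders.
\<close>

lemma (in group) claw_free_imp_ord_le_3:
  assumes free: "claw_free (coprime_graph G)" and fin: "finite (carrier G)"
    and x: "x \<in> carrier G"
  shows "ord x \<le> 3"
proof (rule ccontr)
  assume "\<not> ord x \<le> 3"
  then have nontriv: "x [^] k \<noteq> \<one>" if "k \<in> {1, 2, 3}" for k :: nat
    using that pow_eq_id[OF x, of k] by (auto dest: dvd_imp_le)
  have pows: "x [^] (2::nat) = x \<otimes> x" "x [^] (3::nat) = x \<otimes> x \<otimes> x"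
    using x by (simp_all add: numeral_2_eq_2 numeral_3_eq_3)
  have n1: "x \<noteq> \<one>" and n2: "x \<otimes> x \<noteq> \<one>" and n3: "x \<otimes> x \<otimes> x \<noteq> \<one>"
    using nontriv[of 1] nontriv[of 2] nontriv[of 3] x by (simp_all add: pows)
  define L where "L = {x, inv x, x \<otimes> x}"
  have "x \<noteq> inv x"
    using n2 r_inv[OF x] by auto
  moreover have "inv x \<noteq> x \<otimes> x"
    using n3 l_inv[OF x] by metis
  moreover have "x \<noteq> x \<otimes> x"
    using n1 x by simp
  ultimately have card_L: "card L = 3"
    by (simp add: L_def)
  have "\<one> \<noteq> inv x"
    using n1 x by (metis inv_eq_1_iff)
  then have "L \<subseteq> carrier G" "\<one> \<notin> L"
    using x n1 n2 by (auto simp: L_def)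
  then obtain u v where uv: "u \<in> L" "v \<in> L" "coprime (ord u) (ord v)"
    using claw_free_imp_coprime_pair[OF free fin] card_L by blast
  have "(x \<otimes> x) [^] ord x = \<one>"
    using x by (simp add: pow_mult_distrib)
  then have "ord (x \<otimes> x) dvd ord x"
    using x by (simp add: pow_eq_id)
  then have "ord (x \<otimes> x) dvd ord w" if "w \<in> L" for w
    using that x by (auto simp: L_def)
  with uv have "ord (x \<otimes> x) dvd 1"
    by (meson coprime_common_divisor)
  then show False
    using n2 ord_eq_1[of "x \<otimes> x"] x by simp
qed

lemma (in group) claw_free_imp_card_ord_le_2:
  assumes free: "claw_free (coprime_graph G)" and fin: "finite (carrier G)" and "d \<noteq> 1"
  shows "card {x \<in> carrier G. ord x = d} \<le> 2"
proof (rule ccontr)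
  assume "\<not> ?thesis"
  then have "3 \<le> card {x \<in> carrier G. ord x = d}"
    by simp
  then obtain L where L: "L \<subseteq> {x \<in> carrier G. ord x = d}" "card L = 3"
    by (metis obtain_subset_with_card_n)
  have "\<one> \<notin> L" "L \<subseteq> carrier G"
    using L(1) \<open>d \<noteq> 1\<close> by auto
  then obtain u v where uv: "u \<in> L" "v \<in> L" "coprime (ord u) (ord v)"
    using claw_free_imp_coprime_pair[OF free fin] L(2) by blast
  then have "ord u = d" "ord v = d"
    using L(1) by auto
  with uv(3) show False
    using \<open>d \<noteq> 1\<close> by simp
qed

lemma (in group) claw_free_imp_order_le_3:
  assumes free: "claw_free (coprime_graph G)" and fin: "finite (carrier G)"
  shows "order G \<le> 3"
proof (rule ccontr)
  assume big: "\<not> order G \<le> 3"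
  define S where "S d = {x \<in> carrier G. ord x = d}" for d
  have card_S: "card (S 2) \<le> 2" "card (S 3) \<le> 2"
    unfolding S_def by (simp_all add: claw_free_imp_card_ord_le_2[OF free fin])
  have fin_S: "finite (S d)" for d
    using fin by (simp add: S_def)
  have ord_cases: "x = \<one> \<or> x \<in> S 2 \<or> x \<in> S 3" if x: "x \<in> carrier G" for x
  proof -
    have "ord x \<in> {1, 2, 3}"
      using claw_free_imp_ord_le_3[OF free fin x] ord_ge_1[OF fin x] by auto
    then show ?thesis
      using x ord_eq_1[OF x] by (auto simp: S_def)
  qed
  then have carrier_eq: "carrier G = insert \<one> (S 2 \<union> S 3)"
    by (auto simp: S_def)
  have "order G \<le> Suc (card (S 2) + card (S 3))"
    unfolding order_def carrier_eq
    by (rule le_trans[OF card_insert_le_m1]) (use card_Un_le[of "S 2" "S 3"] in auto)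
  with big card_S have "S 2 \<noteq> {}" "S 3 \<noteq> {}"
    by auto
  then obtain a b where a: "a \<in> carrier G" "ord a = 2" and b: "b \<in> carrier G" "ord b = 3"
    by (auto simp: S_def)
  have b1: "b \<noteq> \<one>"
    using b by auto
  have "b \<otimes> b \<noteq> \<one>"
    using b pow_eq_id[OF b(1), of 2] by (auto simp: numeral_2_eq_2 dest: dvd_imp_le)
  then have b2: "b \<noteq> inv b"
    using b by (metis r_inv)
  have "card {b, inv b} = 2"
    using b2 by simp
  moreover have "{b, inv b} \<subseteq> S 3"
    using b by (simp add: S_def)
  ultimately have S3: "S 3 = {b, inv b}"
    using card_S fin_S by (metis card_seteq)
  have bb: "b \<otimes> b = inv b"
    using b pow_ord_eq_1[OF b(1)] by (simp add: numeral_3_eq_3 inv_equality)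
  \<comment> \<open>As \<open>B\<close> is a subgroup that contains the identity and all elements of order three, every
    element of a coset other than \<open>B\<close> has order two.\<close>
  define B where "B = {\<one>, b, inv b}"
  have B_sub: "B \<subseteq> carrier G"
    using b by (auto simp: B_def)
  have "inv b \<otimes> inv b = b"
    using b bb by (metis inv_inv inv_mult_group)
  then have B_subgroup: "subgroup B G"
    using b bb by unfold_locales (auto simp: B_def)
  have "a \<notin> B"
    using a b by (auto simp: B_def)
  have coset: "(\<otimes>) a ` B \<subseteq> S 2"
  proof
    fix u assume "u \<in> (\<otimes>) a ` B"
    then obtain c where c: "c \<in> B" "u = a \<otimes> c"
      by blast
    have "u \<notin> B"
    proof
      assume "u \<in> B"
      then have "u \<otimes> inv c \<in> B"
        using B_subgroup c by (meson subgroup.m_closed subgroup.m_inv_closed)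
      with c a B_sub \<open>a \<notin> B\<close> show False
        by (auto simp: m_assoc subset_iff)
    qed
    moreover have "u \<in> carrier G"
      using a c B_sub by auto
    ultimately show "u \<in> S 2"
      using ord_cases[of u] S3 by (auto simp: B_def)
  qed
  have "inj_on ((\<otimes>) a) B"
    using a B_sub by (auto simp: inj_on_def subset_iff)
  moreover have "card B = 3"
    using b1 b2 inv_eq_1_iff[OF b(1)] by (auto simp: B_def card_insert_if)
  ultimately have "3 \<le> card (S 2)"
    using card_mono[OF fin_S coset] by (simp add: card_image)
  with card_S show False
    by simp
qed

theorem theorem4:
  fixes G :: "('a, 'm) monoid_scheme"
  assumes "group G" and "finite (carrier G)"
  shows "claw_free (coprime_graph G) \<longleftrightarrow> order G \<le> 3"
proof
  show "order G \<le> 3" if "claw_free (coprime_graph G)"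
    by (rule group.claw_free_imp_order_le_3[OF assms(1) that assms(2)])
next
  assume small: "order G \<le> 3"
  show "claw_free (coprime_graph G)"
    unfolding claw_free_def
  proof
    assume "\<exists>H. induced_subgraph H (coprime_graph G) \<and> complete_bipartite_digraph 1 3 H"
    then obtain H U V where "induced_subgraph H (coprime_graph G)"
      and UV: "verts H = U \<union> V" "U \<inter> V = {}" "card U = 1" "card V = 3"
      by (auto simp: complete_bipartite_digraph_def)
    then have sub: "U \<union> V \<subseteq> carrier G"
      by (auto simp: induced_subgraph_def subgraph_def coprime_graph_def)
    then have "card (U \<union> V) = 4"
      using UV assms(2) by (subst card_Un_disjoint) (auto intro: finite_subset)
    with sub small card_mono[OF assms(2) sub] show False
      by (simp add: order_def)
  qed
qed

end
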